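(* Let $n\ge 2$ be an integer and let $\tilde{R}_n\subset\mathbb{R}^n$ be the convex hull of the vectors $c_1,\ldots,c_{n-1}$, where $c_1=(1,0,\ldots,0)$ and, for $2\le j\le n-1$, $c_j$ is the vector whose coordinates $1,\ldots,j-1$ equal $1$, whose $j$th coordinate equals $n-j+1$, and whose remaining coordinates equal $0$. Then $\tilde{R}_n$ is translation equivalent (by a lattice translation) to a reflexive polytope, with respect to the lattice of integer points in its affine span.
   Context: Equivalently, $\tilde R_n$ is the convex hull of the first $n-1$ columns of the $n\times n$ upper triangular matrix whose first row is all $1$'s, whose diagonal is $(1,n-1,n-2,\ldots,1)$, and whose entries above the diagonal are all $1$; the full set of $n$ columns spans the simplex $R_n$, which is a height-1 lattice pyramid over $\tilde R_n$ with apex $(1,1,\ldots,1)$. A lattice polytope is reflexive if its polar dual (taken relative to its affine lattice with an interior lattice point as origin) is also a lattice polytope. *)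

theory Defs
  imports "HOL-Analysis.Analysis"
begin

definition int_lattice :: "(real ^ 'n) set" where
  "int_lattice = {x. \<forall>i. x $ i \<in> \<int>}"

definition lattice_polytope :: "'a::real_vector set \<Rightarrow> 'a set \<Rightarrow> bool" where
  "lattice_polytope L P \<longleftrightarrow> (\<exists>V. finite V \<and> V \<subseteq> L \<and> P = convex hull V)"

(* Polytopes need not be full-dimensional, so duals are formed relative to the linear span.
   The dual space of a subspace S is identified with S itself through the inner product:
   y in S stands for the functional (\<lambda>x. x \<bullet> y) on S.  Under this identification
   Hom(L, Z) becomes the dual_lattice of L. *)

definition polar_dual :: "'a::euclidean_space set \<Rightarrow> 'a set" where
  "polar_dual P = {y \<in> span P. \<forall>x\<in>P. x \<bullet> y \<le> 1}"

definition dual_lattice :: "'a::euclidean_space set \<Rightarrow> 'a set" where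
  "dual_lattice L = {y \<in> span L. \<forall>x\<in>L. x \<bullet> y \<in> \<int>}"

(* Since 0 lies in the relative interior of P, the affine hull of P is its linear span, and the
   integer points in it form a lattice (a subgroup) spanning it. *)

definition reflexive :: "(real ^ 'n) set \<Rightarrow> bool" where
  "reflexive P \<longleftrightarrow>
     (let L = int_lattice \<inter> affine hull P in
        lattice_polytope L P \<and> 0 \<in> rel_interior P \<and>
        lattice_polytope (dual_lattice L) (polar_dual P))"

definition translation_equivalent :: "(real ^ 'n) set \<Rightarrow> (real ^ 'n) set \<Rightarrow> bool" where
  "translation_equivalent P Q \<longleftrightarrow> (\<exists>t\<in>int_lattice. Q = (\<lambda>x. t + x) ` P)"

(* The coordinates are numbered 1, ..., n = CARD('n) along the linear order of the index type. *)

definition coord_num :: "'n::{finite,linorder} \<Rightarrow> nat" where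
  "coord_num i = card {..i}"

(* The diagonal entry is n - j + 1 except in the first column, where it is 1. *)

definition R_tilde_vertex :: "nat \<Rightarrow> real ^ 'n::{finite,linorder}" where
  "R_tilde_vertex j =
     (\<chi> i. if coord_num i < j then 1
           else if coord_num i = j then (if j = 1 then 1 else real CARD('n) - real j + 1)
           else 0)"

definition R_tilde :: "(real ^ 'n::{finite,linorder}) set" where
  "R_tilde = convex hull (R_tilde_vertex ` {1..CARD('n) - 1})"

end

theory Submission
  imports Defs
begin

text \<open>
  Translating by \<open>-(1, \<dots>, 1, 0)\<close> turns \<open>c\<^sub>1, \<dots>, c\<^bsub>n-1\<^esub>\<close> into integer vectors \<open>v\<^sub>1, \<dots>, v\<^bsub>n-1\<^esub>\<close>
  with \<open>v\<^sub>j \<bullet> v\<^sub>k = -1\<close> for \<open>j \<noteq> k\<close> and with \<open>\<Sum>\<^sub>k 1 / (1 + v\<^sub>k \<bullet> v\<^sub>k) = 1\<close>, a telescoping sum.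
  For every such system the weights \<open>1 / (1 + v\<^sub>k \<bullet> v\<^sub>k)\<close> are the barycentric coordinates of \<open>0\<close>,
  and the polar dual of the simplex \<open>P\<close> spanned by the \<open>v\<^sub>k\<close> is \<open>-P\<close>, which is again integral.
\<close>

section \<open>Simplices with pairwise vertex products -1 and their polar duals\<close>

lemma orthogonal_to_generators_imp_0:
  fixes z :: "'a::euclidean_space"
  assumes "z \<in> span V" and "\<And>u. u \<in> V \<Longrightarrow> z \<bullet> u = 0"
  shows "z = 0"
proof -
  have "orthogonal z z"
    using assms by (intro orthogonal_to_span[of z V]) (auto simp: orthogonal_def)
  then show ?thesis by (simp add: orthogonal_self)
qed

lemma span_convex_hull: "span (convex hull V) = span V"
  by (meson span_eq convex_hull_subset_span hull_subset span_superset subset_trans)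

lemma one_plus_inner_self_pos: "0 < 1 + v \<bullet> v" for v :: "'a::real_inner"
  by (simp add: add_pos_nonneg)

text \<open>The Gram matrix of \<open>V\<close> is D - J, where D is diagonal with entries
  \<open>1 + v \<bullet> v\<close> and J is all ones. Its determinant is det D times one minus the
  sum in \<open>sum_weights\<close>, so that condition says precisely that \<open>V\<close> is
  linearly dependent.\<close>

locale minus_one_simplex =
  fixes V :: "'a::euclidean_space set"
  assumes finite_V: "finite V"
    and inner_distinct: "\<And>v w. v \<in> V \<Longrightarrow> w \<in> V \<Longrightarrow> v \<noteq> w \<Longrightarrow> v \<bullet> w = -1"
    and sum_weights: "(\<Sum>v\<in>V. 1 / (1 + v \<bullet> v)) = 1"
begin

text \<open>This is row \<open>u\<close> of D - J applied to the coefficients \<open>s\<close>: each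
  cross term is \<open>- s v\<close>, and the diagonal term absorbs the missing
  \<open>s u\<close>.\<close>

lemma inner_combination:
  assumes "u \<in> V"
  shows "(\<Sum>v\<in>V. s v *\<^sub>R v) \<bullet> u = s u * (1 + u \<bullet> u) - sum s V"
proof -
  have "(\<Sum>v\<in>V. s v *\<^sub>R v) \<bullet> u = (\<Sum>v\<in>V. s v * (v \<bullet> u))"
    by (simp add: inner_sum_left)
  also have "\<dots> = s u * (u \<bullet> u) + (\<Sum>v\<in>V - {u}. s v * (v \<bullet> u))"
    using assms finite_V by (simp add: sum.remove)
  also have "(\<Sum>v\<in>V - {u}. s v * (v \<bullet> u)) = (\<Sum>v\<in>V - {u}. - s v)"
    using assms by (intro sum.cong) (auto simp: inner_distinct)
  also have "\<dots> = s u - sum s V"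
    using assms finite_V by (simp add: sum_negf sum.remove[of V u s])
  finally show ?thesis by (simp add: algebra_simps)
qed

text \<open>Each weight times its \<open>1 + u \<bullet> u\<close> is 1, and so is the total weight.
  Hence the vector is orthogonal to all of \<open>V\<close>; lying in the span of \<open>V\<close>,
  it vanishes.\<close>

lemma weighted_sum_eq_0: "(\<Sum>v\<in>V. (1 / (1 + v \<bullet> v)) *\<^sub>R v) = 0"
proof (rule orthogonal_to_generators_imp_0)
  show "(\<Sum>v\<in>V. (1 / (1 + v \<bullet> v)) *\<^sub>R v) \<in> span V"
    by (intro span_sum span_scale span_base)
  show "(\<Sum>v\<in>V. (1 / (1 + v \<bullet> v)) *\<^sub>R v) \<bullet> u = 0" if "u \<in> V" for u
    using inner_combination[OF that, of "\<lambda>v. 1 / (1 + v \<bullet> v)"] one_plus_inner_self_pos[of u]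
    by (simp add: sum_weights)
qed

lemma zero_in_rel_interior: "0 \<in> rel_interior (convex hull V)"
proof -
  have "\<exists>u. (\<forall>v\<in>V. 0 < u v) \<and> sum u V = 1 \<and> (\<Sum>v\<in>V. u v *\<^sub>R v) = 0"
    using sum_weights weighted_sum_eq_0 one_plus_inner_self_pos[where 'a = 'a]
    by (intro exI[of _ "\<lambda>v. 1 / (1 + v \<bullet> v)"]) simp
  then show ?thesis
    using explicit_subset_rel_interior_convex_hull_minimal[OF finite_V] by blast
qed

lemma polar_dual_eq: "polar_dual (convex hull V) = convex hull (uminus ` V)"
proof
  show "polar_dual (convex hull V) \<subseteq> convex hull (uminus ` V)"
  proof
    fix y assume "y \<in> polar_dual (convex hull V)"
    then have span: "y \<in> span V" and le: "\<And>v. v \<in> V \<Longrightarrow> v \<bullet> y \<le> 1"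
      by (auto simp: polar_dual_def span_convex_hull hull_inc)
    \<comment> \<open>These coefficients are forced: pairing
      \<open>y = (\<Sum>v\<in>V. s v *\<^sub>R (- v))\<close>, with total weight 1, against
      \<open>u\<close> and solving for \<open>s u\<close> gives this quotient. Its numerator is the
      slack of \<open>y\<close> at a vertex, hence nonnegative.\<close>
    define s where "s v = (1 - v \<bullet> y) / (1 + v \<bullet> v)" for v
    have "sum s V = (\<Sum>v\<in>V. 1 / (1 + v \<bullet> v)) - (\<Sum>v\<in>V. (1 / (1 + v \<bullet> v)) *\<^sub>R v) \<bullet> y"
      unfolding s_def diff_divide_distrib sum_subtractf inner_sum_left by simp
    then have sum_s: "sum s V = 1"
      by (simp add: sum_weights weighted_sum_eq_0)
    have "y + (\<Sum>v\<in>V. s v *\<^sub>R v) = 0"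
    proof (rule orthogonal_to_generators_imp_0)
      show "y + (\<Sum>v\<in>V. s v *\<^sub>R v) \<in> span V"
        by (intro span_add span span_sum span_scale span_base)
      show "(y + (\<Sum>v\<in>V. s v *\<^sub>R v)) \<bullet> u = 0" if "u \<in> V" for u
      proof -
        have "s u * (1 + u \<bullet> u) = 1 - u \<bullet> y"
          using one_plus_inner_self_pos[of u] by (simp add: s_def)
        then show ?thesis
          using inner_combination[OF that, of s]
          by (simp add: inner_add_left sum_s inner_commute[of y u])
      qed
    qed
    then have "y = (\<Sum>v\<in>V. s v *\<^sub>R (- v))"
      by (simp add: sum_negf eq_neg_iff_add_eq_0)
    also have "\<dots> \<in> convex hull (uminus ` V)"
      using le one_plus_inner_self_pos[where 'a = 'a]
      by (intro convex_sum finite_V convex_convex_hull sum_s hull_inc)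
        (auto simp: s_def less_imp_le)
    finally show "y \<in> convex hull (uminus ` V)" .
  qed
  show "convex hull (uminus ` V) \<subseteq> polar_dual (convex hull V)"
  proof (rule hull_minimal)
    show "convex (polar_dual (convex hull V))"
    proof -
      have "polar_dual (convex hull V)
          = span (convex hull V) \<inter> (\<Inter>x\<in>convex hull V. {y. x \<bullet> y \<le> 1})"
        by (auto simp: polar_dual_def)
      then show ?thesis
        by (auto intro!: convex_Int convex_INT convex_halfspace_le
            simp: subspace_imp_convex)
    qed
    show "uminus ` V \<subseteq> polar_dual (convex hull V)"
    proof (rule image_subsetI)
      fix v assume v: "v \<in> V"
      \<comment> \<open>The value is exactly 1 for \<open>w \<noteq> v\<close> and nonpositive for
        \<open>w = v\<close>.\<close>
      have "w \<bullet> (- v) \<le> 1" if "w \<in> V" for w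
        using that v inner_distinct[of w v] one_plus_inner_self_pos[of v] by (cases "w = v") auto
      then have "V \<subseteq> {w. (- v) \<bullet> w \<le> 1}"
        by (auto simp: inner_commute)
      then have "convex hull V \<subseteq> {w. (- v) \<bullet> w \<le> 1}"
        by (intro hull_minimal convex_halfspace_le)
      then show "- v \<in> polar_dual (convex hull V)"
        using v by (auto simp: polar_dual_def span_convex_hull span_base span_neg inner_commute)
    qed
  qed
qed

end

section \<open>From integral vertices to reflexivity\<close>

lemma inner_int_lattice:
  assumes "x \<in> int_lattice" "y \<in> int_lattice"
  shows "x \<bullet> y \<in> \<int>"
  using assms by (auto simp: int_lattice_def inner_vec_def)

text \<open>The polar dual is spanned by the negated vertices. These are integral, so they pair
  integrally with every integer point and belong to the dual lattice.\<close>

lemma reflexive_convex_hull_minus_one_simplex: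
  fixes V :: "(real ^ 'n) set"
  assumes "minus_one_simplex V" "V \<subseteq> int_lattice"
  shows "reflexive (convex hull V)"
proof -
  interpret minus_one_simplex V by fact
  let ?L = "int_lattice \<inter> affine hull (convex hull V)"
  have V_L: "V \<subseteq> ?L"
    using assms(2) by (auto simp: hull_inc)
  have "uminus ` V \<subseteq> dual_lattice ?L"
  proof (rule image_subsetI)
    fix v assume v: "v \<in> V"
    then have "- v \<in> span ?L"
      using V_L by (auto intro: span_neg span_base)
    moreover have "x \<bullet> (- v) \<in> \<int>" if "x \<in> ?L" for x
      using that v assms(2) inner_int_lattice[of x v] by auto
    ultimately show "- v \<in> dual_lattice ?L"
      by (auto simp: dual_lattice_def)
  qed
  then have "lattice_polytope (dual_lattice ?L) (polar_dual (convex hull V))"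
    using finite_V unfolding lattice_polytope_def polar_dual_eq by blast
  moreover have "lattice_polytope ?L (convex hull V)"
    using finite_V V_L unfolding lattice_polytope_def by blast
  ultimately show ?thesis
    using zero_in_rel_interior by (simp add: reflexive_def Let_def)
qed

section \<open>Coordinates of the translated vertices\<close>

lemma bij_betw_coord_num:
  "bij_betw (coord_num :: 'n::{finite,linorder} \<Rightarrow> nat) UNIV {1..CARD('n)}"
proof -
  \<comment> \<open>Initial segments grow strictly, so counting their elements separates the
    indices.\<close>
  have "strict_mono (coord_num :: 'n \<Rightarrow> nat)"
    unfolding coord_num_def by (intro strict_monoI psubset_card_mono) auto
  then have inj: "inj (coord_num :: 'n \<Rightarrow> nat)"
    by (rule strict_mono_imp_inj_on)
  have "range (coord_num :: 'n \<Rightarrow> nat) \<subseteq> {1..CARD('n)}"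
    by (auto simp: coord_num_def Suc_le_eq card_gt_0_iff intro!: card_mono)
  then have "range (coord_num :: 'n \<Rightarrow> nat) = {1..CARD('n)}"
    by (intro card_subset_eq) (auto simp: card_image[OF inj])
  then show ?thesis using inj by (simp add: bij_betw_def)
qed

lemma inner_coord_num:
  "((\<chi> i. f (coord_num i)) :: real ^ 'n::{finite,linorder}) \<bullet> (\<chi> i. g (coord_num i))
    = (\<Sum>k = 1..CARD('n). f k * g k)"
  using sum.reindex_bij_betw[OF bij_betw_coord_num, of "\<lambda>k. f k * g k"]
  by (simp add: inner_vec_def)

text \<open>Coordinate \<open>i\<close> of the \<open>k\<close>th vertex minus (1, ..., 1, 0). The
  case \<open>i = 1\<close> is separate because the first vertex has 1, not \<open>n\<close>, on the
  diagonal.\<close>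

definition shifted_entry :: "nat \<Rightarrow> nat \<Rightarrow> nat \<Rightarrow> real" where
  "shifted_entry n k i =
     (if i < k \<or> i = 1 \<or> n \<le> i then 0 else if i = k then real n - real k else -1)"

lemma R_tilde_vertex_shift:
  assumes "1 \<le> k" "k < CARD('n::{finite,linorder})"
  shows "(\<chi> i. if coord_num i < CARD('n) then -1 else 0) + (R_tilde_vertex k :: real ^ 'n::{finite,linorder})
    = (\<chi> i. shifted_entry CARD('n) k (coord_num i))"
proof -
  have "1 \<le> coord_num i" for i :: 'n
    using bij_betwE[OF bij_betw_coord_num] by (metis UNIV_I atLeastAtMost_iff)
  then show ?thesis
    using assms
    by (auto simp: vec_eq_iff R_tilde_vertex_def shifted_entry_def not_le
        dest: le_neq_implies_less)
qed

text \<open>Serves for products of two columns: they vanish above the lower of the two diagonal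
  positions and at \<open>n\<close>, and are constant in the \<open>n - k - 1\<close> rows
  between.\<close>

lemma sum_from_diagonal:
  fixes f :: "nat \<Rightarrow> real"
  assumes "1 \<le> k" "k < n" "\<And>i. i < k \<Longrightarrow> f i = 0" "f n = 0"
    "\<And>i. k < i \<Longrightarrow> i < n \<Longrightarrow> f i = c"
  shows "(\<Sum>i = 1..n. f i) = f k + (real n - real k - 1) * c"
proof -
  have "(\<Sum>i = 1..n. f i) = (\<Sum>i\<in>insert k {k<..<n}. f i)"
  proof (rule sum.mono_neutral_right)
    show "\<forall>i\<in>{1..n} - insert k {k<..<n}. f i = 0"
    proof
      fix i assume "i \<in> {1..n} - insert k {k<..<n}"
      then have "i < k \<or> i = n" using assms by auto
      then show "f i = 0" using assms by auto
    qed
  qed (use assms in auto)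
  also have "\<dots> = f k + (\<Sum>i\<in>{k<..<n}. c)"
    by (simp add: assms(5))
  also have "\<dots> = f k + (real n - real k - 1) * c"
    using assms by (simp add: of_nat_diff)
  finally show ?thesis .
qed

text \<open>Row \<open>k\<close> contributes \<open>-(n - k)\<close>, and each of the
  \<open>n - k - 1\<close> rows after it contributes \<open>(-1) * (-1)\<close>.\<close>

lemma sum_shifted_entry_distinct:
  assumes "1 \<le> j" "j < k" "k < n"
  shows "(\<Sum>i = 1..n. shifted_entry n j i * shifted_entry n k i) = -1"
  using assms by (subst sum_from_diagonal[where k = k and c = 1]) (auto simp: shifted_entry_def)

lemma sum_shifted_entry_same:
  assumes "1 \<le> k" "k < n"
  shows "1 + (\<Sum>i = 1..n. shifted_entry n k i * shifted_entry n k i)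
    = (if k = 1 then real n - 1 else (real n - real k) * (real n - real k + 1))"
  using assms
  by (subst sum_from_diagonal[where k = k and c = 1]) (auto simp: shifted_entry_def algebra_simps)

text \<open>A term with \<open>k \<ge> 2\<close> equals
  \<open>1 / (n - k) - 1 / (n - k + 1)\<close>. These telescope to \<open>1 - 1 / (n - 1)\<close>,
  and column 1 supplies the rest.\<close>

lemma sum_shifted_weights:
  assumes "2 \<le> n"
  shows "(\<Sum>k = 1..n - 1. 1 / (if k = 1 then real n - 1
    else (real n - real k) * (real n - real k + 1))) = 1"
proof -
  define h where "h k = 1 / (real n - real k)" for k
  \<comment> \<open>Starting at \<open>m = 1\<close> with an empty sum also covers
    \<open>n = 2\<close>, where column 1 is the only one.\<close>
  have tele: "(\<Sum>k = 2..m. 1 / ((real n - real k) * (real n - real k + 1))) = h m - h 1"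
    if "1 \<le> m" "m < n" for m
    using that
  proof (induction m rule: dec_induct)
    case (step m)
    then have "1 / ((real n - real (Suc m)) * (real n - real (Suc m) + 1)) = h (Suc m) - h m"
      by (simp add: h_def field_simps)
    then show ?case using step by simp
  qed simp
  have "(\<Sum>k = 1..n - 1. 1 / (if k = 1 then real n - 1
      else (real n - real k) * (real n - real k + 1)))
    = h 1 + (\<Sum>k = 2..n - 1. 1 / (if k = 1 then real n - 1
      else (real n - real k) * (real n - real k + 1)))"
    using assms by (subst sum.atLeast_Suc_atMost) (auto simp: h_def numeral_2_eq_2)
  also have "\<dots> = h 1 + (\<Sum>k = 2..n - 1. 1 / ((real n - real k) * (real n - real k + 1)))"
    by (intro arg_cong2[where f = "(+)"] refl sum.cong) auto
  also have "\<dots> = 1"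
    using assms by (subst tele) (auto simp: h_def of_nat_diff)
  finally show ?thesis .
qed

section \<open>Reflexivity of the translated polytope\<close>

theorem theorem3:
  assumes "CARD('n::{finite,linorder}) \<ge> 2"
  shows "\<exists>Q. translation_equivalent (R_tilde :: (real ^ ('n::{finite,linorder})) set) Q \<and> reflexive Q"
proof -
  let ?n = "CARD('n)"
  define v :: "nat \<Rightarrow> real ^ 'n::{finite,linorder}" where "v k = (\<chi> i. shifted_entry ?n k (coord_num i))" for k
  define t :: "real ^ 'n::{finite,linorder}" where "t = (\<chi> i. if coord_num i < ?n then -1 else 0)"
  let ?V = "v ` {1..?n - 1}"
  have v_distinct: "v j \<bullet> v k = -1" if "j \<in> {1..?n - 1}" "k \<in> {1..?n - 1}" "j \<noteq> k" for j k
  proof -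
    have *: "v j \<bullet> v k = -1" if "1 \<le> j" "j < k" "k < ?n" for j k
      unfolding v_def inner_coord_num using that by (rule sum_shifted_entry_distinct)
    have "j < ?n" "k < ?n" using that assms by auto
    then show ?thesis
      using that *[of j k] *[of k j] by (cases j k rule: linorder_cases) (auto simp: inner_commute)
  qed
  \<comment> \<open>Equal vectors at distinct indices would have squared norm -1. Injectivity lets
    the weights be summed over indices instead of over the set of vertices.\<close>
  have inj: "inj_on v {1..?n - 1}"
  proof (rule inj_onI, rule ccontr)
    fix j k assume "j \<in> {1..?n - 1}" "k \<in> {1..?n - 1}" "v j = v k" "j \<noteq> k"
    then have "v k \<bullet> v k = -1" using v_distinct by metis
    then show False using inner_ge_zero[of "v k"] by linarith
  qed
  have "(\<Sum>w\<in>?V. 1 / (1 + w \<bullet> w)) = (\<Sum>k = 1..?n - 1. 1 / (1 + v k \<bullet> v k))"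
    using inj by (simp add: sum.reindex)
  also have "\<dots> = (\<Sum>k = 1..?n - 1. 1 / (if k = 1 then real ?n - 1
      else (real ?n - real k) * (real ?n - real k + 1)))"
  proof (rule sum.cong)
    fix k assume "k \<in> {1..?n - 1}"
    then have "1 \<le> k" "k < ?n" using assms by auto
    then show "1 / (1 + v k \<bullet> v k) = 1 / (if k = 1 then real ?n - 1
      else (real ?n - real k) * (real ?n - real k + 1))"
      unfolding v_def inner_coord_num by (simp only: sum_shifted_entry_same)
  qed simp
  also have "\<dots> = 1" using assms by (rule sum_shifted_weights)
  finally have weights: "(\<Sum>w\<in>?V. 1 / (1 + w \<bullet> w)) = 1" .
  have "minus_one_simplex ?V"
  proof
    show "x \<bullet> y = -1" if xy: "x \<in> ?V" "y \<in> ?V" "x \<noteq> y" for x y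
    proof -
      obtain j k where "j \<in> {1..?n - 1}" "k \<in> {1..?n - 1}" "x = v j" "y = v k"
        using xy(1,2) by blast
      then show ?thesis using xy(3) v_distinct[of j k] by blast
    qed
  qed (simp, rule weights)
  moreover have "?V \<subseteq> int_lattice"
    by (auto simp: int_lattice_def v_def shifted_entry_def)
  ultimately have "reflexive (convex hull ?V)"
    by (intro reflexive_convex_hull_minus_one_simplex)
  moreover have "convex hull ?V = (\<lambda>x. t + x) ` R_tilde"
  proof -
    have "?V = (\<lambda>x. t + x) ` R_tilde_vertex ` {1..?n - 1}"
      unfolding image_image t_def v_def
      using assms by (intro image_cong refl) (auto intro!: R_tilde_vertex_shift[symmetric])
    then show ?thesis
      by (simp add: R_tilde_def convex_hull_translation)
  qed
  moreover have "t \<in> int_lattice"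
    by (simp add: int_lattice_def t_def)
  ultimately show ?thesis
    unfolding translation_equivalent_def by metis
qed

end
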